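(* Let $\alpha\in(0,1)$, let $0=t_0<t_1<\cdots<t_N=T$ be an arbitrary time mesh, let $a_{n-k}^{(\mathrm{h},n)}$ be the L1$_{\mathrm h}$ kernels of order $\alpha$ on this mesh, let $\mathsf{a}_{n-k}^{(\mathrm{h},n)}$ be the auxiliary L1$_{\mathrm h}$ kernels and let $\mathsf{p}_{n-k}^{(\mathrm{h},n)}$ be the discrete complementary convolution (DCC) kernels associated with the auxiliary kernels. Let $1\le n\le N$. For any real sequence $\{w_k\}_{k=1}^n$, it holds that $$2w_k\sum_{j=1}^k a_{k-j}^{(\mathrm{h},k)}w_j\ \ge\ \sum_{j=1}^k \mathsf{p}_{k-j}^{(\mathrm{h},k)}\Big(\sum_{\ell=1}^j \mathsf{a}_{j-\ell}^{(\mathrm{h},j)}w_\ell\Big)^2-\sum_{j=1}^{k-1}\mathsf{p}_{k-1-j}^{(\mathrm{h},k-1)}\Big(\sum_{\ell=1}^j \mathsf{a}_{j-\ell}^{(\mathrm{h},j)}w_\ell\Big)^2\qquad\text{for }1\le k\le n,$$ so that the L1$_{\mathrm h}$ kernels are positive definite in the sense that $$2\sum_{k=1}^n w_k\sum_{j=1}^k a_{k-j}^{(\mathrm{h},k)}w_j\ \ge\ \sum_{k=1}^n \mathsf{p}_{n-k}^{(\mathrm{h},n)}\Big(\sum_{j=1}^k \mathsf{a}_{k-j}^{(\mathrm{h},k)}w_j\Big)^2\ >\ 0\qquad\text{if } w_k\not\equiv 0.$$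
   Context: Let $\omega_\beta(t):=t^{\beta-1}/\Gamma(\beta)$ for $\beta>0$, $t>0$, $\tau_k:=t_k-t_{k-1}$, and $t_{n-\frac12}:=(t_n+t_{n-1})/2$. The L1$_{\mathrm h}$ kernels are, for $1\le k\le n\le N$, $$a_{n-k}^{(\mathrm{h},n)}:=\frac1{\tau_k}\int_{t_{k-1}}^{\min\{t_k,\,t_{n-\frac12}\}}\omega_{1-\alpha}(t_{n-\frac12}-s)\,\mathrm{d}s .$$ The auxiliary L1$_{\mathrm h}$ kernels are $$\mathsf{a}_0^{(\mathrm{h},n)}:=2a_0^{(\mathrm{h},n)},\qquad \mathsf{a}_j^{(\mathrm{h},n)}:=a_j^{(\mathrm{h},n)}\quad(1\le j\le n-1).$$ The discrete orthogonal convolution (DOC) kernels of the auxiliary kernels are defined recursively by $$\vartheta_0^{(\mathrm{h},n)}:=\frac1{\mathsf{a}_0^{(\mathrm{h},n)}},\qquad \vartheta_{n-k}^{(\mathrm{h},n)}:=-\frac1{\mathsf{a}_0^{(\mathrm{h},k)}}\sum_{j=k+1}^n\vartheta_{n-j}^{(\mathrm{h},n)}\mathsf{a}_{j-k}^{(\mathrm{h},j)}\quad(1\le k\le n-1),$$ and the DCC kernels by $\mathsf{p}_{n-k}^{(\mathrm{h},n)}:=\sum_{j=k}^n\vartheta_{j-k}^{(\mathrm{h},j)}$ for $1\le k\le n$. Empty sums are zero. *)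

theory Defs
  imports "HOL-Analysis.Analysis"
begin

text \<open>
  A mesh is a function \<open>t\<close> on the naturals, of which only \<open>t 0, \<dots>, t N\<close> matter.  A kernel family
  \<open>A\<close> is written with the superscript first: \<open>A n j\<close> is $A_j^{(n)}$, meaningful for
  \<open>j < n\<close>.
\<close>

text \<open>Only arguments \<open>x > 0\<close> are meaningful; the total function gives \<open>omega \<beta> 0 = 0\<close>.\<close>

definition omega :: "real \<Rightarrow> real \<Rightarrow> real" where
  "omega \<beta> x = x powr (\<beta> - 1) / Gamma \<beta>"

definition step :: "(nat \<Rightarrow> real) \<Rightarrow> nat \<Rightarrow> real" where
  "step t k = t k - t (k - 1)"

definition midpt :: "(nat \<Rightarrow> real) \<Rightarrow> nat \<Rightarrow> real" where
  "midpt t n = (t n + t (n - 1)) / 2"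

text \<open>
  The subscript \<open>j\<close> stands for \<open>n - k\<close>, so \<open>k\<close> is recovered as \<open>n - j\<close>.  For \<open>k = n\<close> the integrand
  is weakly singular at the upper limit; its value at that single point is irrelevant.
\<close>

definition l1h :: "real \<Rightarrow> (nat \<Rightarrow> real) \<Rightarrow> nat \<Rightarrow> nat \<Rightarrow> real" where
  "l1h \<alpha> t n j =
    (let k = n - j in
      1 / step t k *
      integral {t (k - 1) .. min (t k) (midpt t n)} (\<lambda>s. omega (1 - \<alpha>) (midpt t n - s)))"

definition aux_l1h :: "real \<Rightarrow> (nat \<Rightarrow> real) \<Rightarrow> nat \<Rightarrow> nat \<Rightarrow> real" where
  "aux_l1h \<alpha> t n j = (if j = 0 then 2 * l1h \<alpha> t n 0 else l1h \<alpha> t n j)"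

function doc :: "(nat \<Rightarrow> nat \<Rightarrow> real) \<Rightarrow> nat \<Rightarrow> nat \<Rightarrow> real" where
  "doc A n m =
    (if m = 0 then 1 / A n 0
     else - (1 / A (n - m) 0) *
       (\<Sum>j = n - m + 1..n. doc A n (n - j) * A j (j - (n - m))))"
  by pat_completeness auto
termination
  by (relation "Wellfounded.measure (\<lambda>(A, n, m). m)") auto

declare doc.simps [simp del]

lemma doc_0: "doc A n 0 = 1 / A n 0"
  by (simp add: doc.simps)

lemma doc_rec:
  assumes "1 \<le> k" "k < n"
  shows "doc A n (n - k) = - (1 / A k 0) * (\<Sum>j = k + 1..n. doc A n (n - j) * A j (j - k))"
  using assms by (subst doc.simps) simp

definition dcc :: "(nat \<Rightarrow> nat \<Rightarrow> real) \<Rightarrow> nat \<Rightarrow> nat \<Rightarrow> real" where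
  "dcc A n m = (let k = n - m in \<Sum>j = k..n. doc A j (j - k))"

end

theory Submission
  imports Defs
begin

text \<open>
  Write \<open>M n k\<close> for \<open>A n (n - k)\<close> and regard \<open>M\<close> as a lower triangular matrix.  The orthogonality
  recursion says that the DOC kernels \<open>\<Theta> n k = doc A n (n - k)\<close> form its left inverse, so with
  \<open>V j = (\<Sum>l = 1..j. M j l * w l)\<close> one recovers \<open>w k = (\<Sum>j = 1..k. \<Theta> k j * V j)\<close>, while the
  difference of the DCC kernels at the levels \<open>k\<close> and \<open>k - 1\<close> is the row \<open>\<Theta> k\<close>.  As the diagonal of
  \<open>M\<close> is twice that of the original kernels, the left-hand side at level \<open>k\<close> equals
  \<open>2 * w k * V k - M k k * (w k)\<^sup>2\<close>.  Put \<open>q = - (\<Sum>j < k. \<Theta> k j * V j)\<close>, so that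
  \<open>w k = V k / M k k - q\<close>.  Completing the square turns this into \<open>(V k)\<^sup>2 / M k k - M k k * q\<^sup>2\<close>, and
  the claim becomes
  \<open>q\<^sup>2 \<le> \<Theta> k k * (\<Sum>j < k. - \<Theta> k j * (V j)\<^sup>2)\<close>.  By Cauchy-Schwarz this follows once the
  off-diagonal \<open>\<Theta> k j\<close> are nonpositive and every row sum of \<open>\<Theta>\<close> is nonnegative.  Summation over \<open>k\<close>
  telescopes, and the final strict inequality needs the DCC kernels to be positive.

  These three properties of \<open>\<Theta>\<close> reflect three properties of \<open>M\<close>.  Monotone rows make the DCC
  kernels positive, monotone columns make the row sums of \<open>\<Theta>\<close> nonnegative, and the decrease in \<open>k\<close>
  of the quotient \<open>M n k / M (n - 1) k\<close> makes \<open>\<Theta>\<close> nonpositive off the diagonal.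

  For the L1h kernels the factor 2 on the diagonal has a simple meaning: every \<open>M n k\<close>, the diagonal
  included, is the mean of the power kernel \<open>s \<mapsto> \<omega>(c - s)\<close> over the interval on which it is
  integrated, where \<open>c\<close> is the midpoint of the \<open>n\<close>-th cell.  Rows are then monotone as \<open>\<omega>\<close> is
  decreasing.  Columns and quotients are controlled by the fact that \<open>\<omega>(c - s) / \<omega>(b - s)\<close> decreases in
  \<open>s\<close> for \<open>b < c\<close>.  The only comparison of means over different intervals is that of \<open>M n (n - 1)\<close>
  with \<open>M (n - 1) (n - 1)\<close>; there the antiderivative is used.
\<close>

section \<open>Triangular kernels and their discrete inverses\<close>

lemma sum_triangle_swap:
  fixes f :: "nat \<Rightarrow> nat \<Rightarrow> 'a :: comm_monoid_add"
  shows "(\<Sum>j = k..n. \<Sum>l = k..j. f j l) = (\<Sum>l = k..n. \<Sum>j = l..n. f j l)"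
proof -
  have "(\<Sum>j = k..n. \<Sum>l = k..j. f j l) = (\<Sum>j = k..n. \<Sum>l | l \<in> {k..n} \<and> l \<le> j. f j l)"
    by (intro sum.cong refl) auto
  also have "\<dots> = (\<Sum>l = k..n. \<Sum>j | j \<in> {k..n} \<and> l \<le> j. f j l)"
    by (rule sum.swap_restrict) auto
  also have "\<dots> = (\<Sum>l = k..n. \<Sum>j = l..n. f j l)"
    by (intro sum.cong refl) auto
  finally show ?thesis .
qed

text \<open>
  The quotient condition is cross-multiplied in \<open>minor\<close>: with row \<open>Suc n\<close> placed above row \<open>n\<close>, the
  minors of \<open>M\<close> on these two rows are nonnegative.  It is required for all column pairs and not only
  for neighbours, as this is the form in which the sign argument uses it.
\<close>

locale monotone_kernel =
  fixes A :: "nat \<Rightarrow> nat \<Rightarrow> real" and N :: nat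
  assumes pos: "1 \<le> k \<Longrightarrow> k \<le> n \<Longrightarrow> n \<le> N \<Longrightarrow> 0 < A n (n - k)"
    and row: "1 \<le> k \<Longrightarrow> k < n \<Longrightarrow> n \<le> N \<Longrightarrow> A n (n - k) < A n (n - Suc k)"
    and col: "1 \<le> k \<Longrightarrow> k \<le> n \<Longrightarrow> Suc n \<le> N \<Longrightarrow> A (Suc n) (Suc n - k) \<le> A n (n - k)"
    and minor: "1 \<le> k \<Longrightarrow> k < j \<Longrightarrow> j \<le> n \<Longrightarrow> Suc n \<le> N \<Longrightarrow>
      A n (n - k) * A (Suc n) (Suc n - j) \<le> A n (n - j) * A (Suc n) (Suc n - k)"
begin

abbreviation M :: "nat \<Rightarrow> nat \<Rightarrow> real" where "M n k \<equiv> A n (n - k)"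
abbreviation \<Theta> :: "nat \<Rightarrow> nat \<Rightarrow> real" where "\<Theta> n k \<equiv> doc A n (n - k)"
abbreviation P :: "nat \<Rightarrow> nat \<Rightarrow> real" where "P n k \<equiv> dcc A n (n - k)"

lemma doc_diag_pos: "1 \<le> n \<Longrightarrow> n \<le> N \<Longrightarrow> 0 < \<Theta> n n"
  using pos[of n n] by (simp add: doc_0)

lemma doc_left_inverse:
  assumes "1 \<le> k" "k \<le> n" "n \<le> N"
  shows "(\<Sum>j = k..n. \<Theta> n j * M j k) = (if k = n then 1 else 0)"
proof (cases "k = n")
  case True
  then show ?thesis using pos[of n n] assms by (simp add: doc_0)
next
  case False
  then have "k < n" using assms by simp
  then have "(\<Sum>j = k..n. \<Theta> n j * M j k) = \<Theta> n k * A k 0 + (\<Sum>j = k + 1..n. \<Theta> n j * M j k)"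
    by (subst sum.atLeast_Suc_atMost) auto
  also have "\<dots> = 0"
    using pos[of k k] assms \<open>k < n\<close> by (simp add: doc_rec)
  finally show ?thesis using False by simp
qed

lemma doc_inverts:
  assumes "1 \<le> n" "n \<le> N"
  shows "(\<Sum>j = 1..n. \<Theta> n j * (\<Sum>l = 1..j. M j l * w l)) = w n"
proof -
  have "(\<Sum>j = 1..n. \<Theta> n j * (\<Sum>l = 1..j. M j l * w l))
      = (\<Sum>l = 1..n. \<Sum>j = l..n. \<Theta> n j * M j l * w l)"
    unfolding sum_distrib_left mult.assoc[symmetric] by (rule sum_triangle_swap)
  also have "\<dots> = (\<Sum>l = 1..n. (if l = n then w l else 0))"
    unfolding sum_distrib_right[symmetric]
    by (intro sum.cong refl) (use assms in \<open>simp add: doc_left_inverse\<close>)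
  also have "\<dots> = w n" using assms by simp
  finally show ?thesis .
qed

text \<open>
  A left inverse of a triangular matrix is a right inverse: the residual \<open>r = z - M (\<Theta> z)\<close>
  satisfies \<open>\<Theta> r = 0\<close>, and forward substitution with the nonzero diagonal of \<open>\<Theta>\<close> gives \<open>r = 0\<close>.
\<close>

lemma doc_right_inverse_apply:
  assumes "1 \<le> n" "n \<le> N"
  shows "(\<Sum>j = 1..n. M n j * (\<Sum>i = 1..j. \<Theta> j i * z i)) = z n"
proof -
  define y where "y j = (\<Sum>i = 1..j. \<Theta> j i * z i)" for j
  define r where "r n = z n - (\<Sum>j = 1..n. M n j * y j)" for n
  have ker: "(\<Sum>j = 1..n. \<Theta> n j * r j) = 0" if "1 \<le> n" "n \<le> N" for n
    using doc_inverts[OF that, of y] unfolding r_def y_def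
    by (simp add: right_diff_distrib sum_subtractf)
  have "r n = 0" if "1 \<le> n" "n \<le> N" for n
    using that
  proof (induction n rule: less_induct)
    case (less n)
    obtain m where m: "n = Suc m" using less.prems by (cases n) auto
    have "(\<Sum>j = 1..m. \<Theta> n j * r j) = 0"
      using less m by (intro sum.neutral) auto
    then have "\<Theta> n n * r n = 0" using ker[OF less.prems] m by simp
    then show ?case using doc_diag_pos[OF less.prems] by simp
  qed
  then show ?thesis using assms unfolding r_def y_def by simp
qed

lemma doc_right_inverse:
  assumes "1 \<le> k" "k < n" "n \<le> N"
  shows "(\<Sum>j = k..n. M n j * \<Theta> j k) = 0"
proof -
  have "(\<Sum>j = 1..n. M n j * (\<Sum>i = 1..j. \<Theta> j i * of_bool (i = k))) = 0"
    using doc_right_inverse_apply[of n "\<lambda>i. of_bool (i = k)"] assms by simp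
  moreover have "(\<Sum>i = 1..j. \<Theta> j i * of_bool (i = k)) = (if k \<le> j then \<Theta> j k else 0)" for j
  proof -
    have "(\<Sum>i = 1..j. \<Theta> j i * of_bool (i = k)) = (\<Sum>i = 1..j. if k = i then \<Theta> j i else 0)"
      by (intro sum.cong) auto
    then show ?thesis using assms by simp
  qed
  ultimately have "(\<Sum>j = 1..n. M n j * (if k \<le> j then \<Theta> j k else 0)) = 0" by simp
  moreover have "(\<Sum>j = 1..n. M n j * (if k \<le> j then \<Theta> j k else 0)) = (\<Sum>j = k..n. M n j * \<Theta> j k)"
    using assms by (intro sum.mono_neutral_cong_right) auto
  ultimately show ?thesis by simp
qed

text \<open>
  For \<open>m > k\<close> the column \<open>k\<close> of \<open>\<Theta>\<close> is orthogonal to row \<open>m\<close> of \<open>M\<close>.  Passing to row \<open>Suc m\<close> multiplies the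
  \<open>j\<close>-th term by the quotient \<open>M (Suc m) j / M m j\<close>.  The quotient is largest at \<open>j = k\<close>, where the only
  positive term sits, so the sum over \<open>j \<le> m\<close> becomes nonnegative and the new entry must compensate
  for it.
\<close>

lemma doc_offdiag_nonpos:
  assumes "1 \<le> k" "k < n" "n \<le> N"
  shows "\<Theta> n k \<le> 0"
  using assms(2,3)
proof (induction n rule: less_induct)
  case (less n)
  obtain m where m: "n = Suc m" using less.prems by (cases n) auto
  have km: "k \<le> m" "m \<le> N" "1 \<le> m" using less.prems m assms(1) by auto
  have ge: "0 \<le> (\<Sum>j = k..m. M n j * \<Theta> j k)"
  proof (cases "k = m")
    case True
    then show ?thesis
      using pos[of k n] doc_diag_pos[of k] assms(1) less.prems
      by (simp add: less_imp_le)
  next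
    case False
    then have "k < m" using km by simp
    have "M n k * (\<Sum>j = k..m. M m j * \<Theta> j k) \<le> M m k * (\<Sum>j = k..m. M n j * \<Theta> j k)"
      unfolding sum_distrib_left
    proof (rule sum_mono)
      fix j assume j: "j \<in> {k..m}"
      show "M n k * (M m j * \<Theta> j k) \<le> M m k * (M n j * \<Theta> j k)"
      proof (cases "j = k")
        case False
        then have "\<Theta> j k \<le> 0" using less.IH[of j] j m km by auto
        moreover have "M m k * M n j \<le> M n k * M m j"
          using minor[of k j m] False j m less.prems assms(1) by (auto simp: mult.commute)
        ultimately have "M n k * M m j * \<Theta> j k \<le> M m k * M n j * \<Theta> j k"
          by (intro mult_right_mono_neg)
        then show ?thesis by (simp only: mult.assoc)
      qed (simp add: mult.left_commute)
    qed
    moreover have "(\<Sum>j = k..m. M m j * \<Theta> j k) = 0"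
      using doc_right_inverse[OF assms(1) \<open>k < m\<close>] km by simp
    ultimately show ?thesis
      using pos[of k m] assms(1) km by (simp add: zero_le_mult_iff)
  qed
  have "(\<Sum>j = k..n. M n j * \<Theta> j k) = (\<Sum>j = k..m. M n j * \<Theta> j k) + M n n * \<Theta> n k"
    unfolding m using km by (subst sum.nat_ivl_Suc') auto
  then have "M n n * \<Theta> n k \<le> 0"
    using ge doc_right_inverse[OF assms(1) less.prems] by simp
  then show ?case using pos[of n n] assms(1) less.prems by (simp add: mult_le_0_iff)
qed

text \<open>
  The vector \<open>v\<close> of row sums of \<open>\<Theta>\<close> solves \<open>M v = 1\<close>.  Subtracting consecutive equations expresses
  \<open>M n n * v n\<close> through earlier entries with the coefficients \<open>M (n - 1) k - M n k\<close>, which are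
  nonnegative when columns decrease.
\<close>

lemma doc_row_sum_nonneg:
  assumes "1 \<le> n" "n \<le> N"
  shows "0 \<le> (\<Sum>j = 1..n. \<Theta> n j)"
proof -
  define v where "v n = (\<Sum>j = 1..n. \<Theta> n j)" for n
  have eq: "(\<Sum>j = 1..n. M n j * v j) = 1" if "1 \<le> n" "n \<le> N" for n
    using doc_right_inverse_apply[OF that, of "\<lambda>_. 1"] by (simp add: v_def)
  have "0 \<le> v n" using assms
  proof (induction n rule: less_induct)
    case (less n)
    obtain m where m: "n = Suc m" using less.prems by (cases n) auto
    show ?case
    proof (cases "m = 0")
      case True
      then show ?thesis using doc_diag_pos[of n] less.prems m by (simp add: v_def)
    next
      case False
      have "(\<Sum>j = 1..m. M n j * v j) \<le> (\<Sum>j = 1..m. M m j * v j)"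
        using less m col[of _ m] by (intro sum_mono mult_right_mono) auto
      moreover have "(\<Sum>j = 1..n. M n j * v j) = (\<Sum>j = 1..m. M n j * v j) + M n n * v n"
        unfolding m by simp
      ultimately have "0 \<le> M n n * v n" using eq[of n] eq[of m] less.prems m False by simp
      then show ?thesis using pos[of n n] less.prems by (simp add: zero_le_mult_iff)
    qed
  qed
  then show ?thesis by (simp add: v_def)
qed

lemma dcc_eq_column_sum: "k \<le> n \<Longrightarrow> P n k = (\<Sum>j = k..n. \<Theta> j k)"
  by (simp add: dcc_def)

lemma dcc_complementary:
  assumes "1 \<le> k" "k \<le> n" "n \<le> N"
  shows "(\<Sum>j = k..n. P n j * M j k) = 1"
proof -
  have "(\<Sum>j = k..n. P n j * M j k) = (\<Sum>j = k..n. \<Sum>i = j..n. \<Theta> i j * M j k)"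
    by (intro sum.cong refl) (simp add: dcc_eq_column_sum sum_distrib_right)
  also have "\<dots> = (\<Sum>i = k..n. \<Sum>j = k..i. \<Theta> i j * M j k)"
    by (rule sum_triangle_swap[symmetric])
  also have "\<dots> = (\<Sum>i = k..n. if k = i then 1 else 0)"
    by (intro sum.cong refl, subst doc_left_inverse) (use assms in auto)
  also have "\<dots> = 1" using assms by simp
  finally show ?thesis .
qed

text \<open>
  Subtracting the complementary identities of the columns \<open>k\<close> and \<open>Suc k\<close> expresses
  \<open>P n k * M k k\<close> through the \<open>P n j\<close> with \<open>j > k\<close>; the coefficients \<open>M j (Suc k) - M j k\<close> are positive
  because rows increase.
\<close>

lemma dcc_pos:
  assumes "1 \<le> k" "k \<le> n" "n \<le> N"
  shows "0 < P n k"
  using assms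
proof (induction "n - k" arbitrary: k rule: less_induct)
  case less
  show ?case
  proof (cases "k = n")
    case True
    then show ?thesis using doc_diag_pos[of n] less.prems by (simp add: dcc_eq_column_sum dcc_def)
  next
    case False
    then have kn: "k < n" using less.prems by simp
    have "(\<Sum>j = Suc k..n. P n j * M j k) < (\<Sum>j = Suc k..n. P n j * M j (Suc k))"
    proof (rule sum_strict_mono)
      fix j assume j: "j \<in> {Suc k..n}"
      have "0 < P n j" using less.hyps[of j] less.prems j by auto
      moreover have "M j k < M j (Suc k)" using row[of k j] less.prems j by auto
      ultimately show "P n j * M j k < P n j * M j (Suc k)" by simp
    qed (use kn in auto)
    moreover have "(\<Sum>j = Suc k..n. P n j * M j (Suc k)) = 1"
      using dcc_complementary[of "Suc k" n] kn less.prems by simp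
    moreover have "(\<Sum>j = k..n. P n j * M j k) = P n k * M k k + (\<Sum>j = Suc k..n. P n j * M j k)"
      using kn by (subst sum.atLeast_Suc_atMost) auto
    ultimately have "0 < P n k * M k k" using dcc_complementary[OF less.prems] by simp
    then show ?thesis using pos[of k k] less.prems by (simp add: zero_less_mult_iff)
  qed
qed

lemma dcc_weighted_sum_diff:
  assumes "1 \<le> k"
  shows "(\<Sum>j = 1..k. P k j * f j) - (\<Sum>j = 1..k - 1. P (k - 1) j * f j) = (\<Sum>j = 1..k. \<Theta> k j * f j)"
proof -
  obtain m where m: "k = Suc m" using assms by (cases k) auto
  have "(\<Sum>j = 1..m. P k j * f j) = (\<Sum>j = 1..m. P m j * f j + \<Theta> k j * f j)"
  proof (intro sum.cong refl)
    fix j assume "j \<in> {1..m}"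
    then have "P k j = P m j + \<Theta> k j" unfolding m by (simp add: dcc_def)
    then show "P k j * f j = P m j * f j + \<Theta> k j * f j" by (simp add: distrib_right)
  qed
  then show ?thesis by (simp add: m dcc_def sum.distrib)
qed

section \<open>The local energy inequality\<close>

text \<open>
  The right-hand side is \<open>2 * w k * (V k - M k k * w k / 2)\<close>, where halving the diagonal of the auxiliary
  kernels restores the original ones.  The weights \<open>u j = - \<Theta> k j\<close> are nonnegative and sum to at
  most \<open>\<Theta> k k\<close>, so the weighted Cauchy-Schwarz inequality absorbs the square of the history term \<open>q\<close>.
\<close>

lemma doc_quadratic_bound:
  fixes w :: "nat \<Rightarrow> real"
  defines "V \<equiv> \<lambda>j. \<Sum>l = 1..j. M j l * w l"
  assumes "1 \<le> k" "k \<le> N"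
  shows "(\<Sum>j = 1..k. \<Theta> k j * (V j)\<^sup>2) \<le> 2 * w k * V k - M k k * (w k)\<^sup>2"
proof -
  obtain m where m: "k = Suc m" using assms by (cases k) auto
  define u where "u j = - \<Theta> k j" for j
  define q where "q = (\<Sum>j = 1..m. u j * V j)"
  have u: "0 \<le> u j" if "j \<in> {1..m}" for j
    using doc_offdiag_nonpos[of j k] that assms m by (simp add: u_def)
  have d: "0 < M k k" using pos[of k k] assms by simp
  have "(\<Sum>j = 1..k. \<Theta> k j * V j) = w k"
    unfolding V_def by (rule doc_inverts) fact+
  then have w: "w k = V k / M k k - q"
    by (simp add: m q_def u_def sum_negf doc_0)
  have sum_u: "(\<Sum>j = 1..m. u j) \<le> 1 / M k k"
    using doc_row_sum_nonneg[OF assms(2,3)] by (simp add: m u_def sum_negf doc_0)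
  \<comment> \<open>The weights are distributed evenly over the two factors.\<close>
  have "q\<^sup>2 = (\<Sum>j = 1..m. sqrt (u j) * (sqrt (u j) * V j))\<^sup>2"
    unfolding q_def mult.assoc[symmetric] by (simp add: u)
  also have "\<dots> \<le> (\<Sum>j = 1..m. (sqrt (u j))\<^sup>2) * (\<Sum>j = 1..m. (sqrt (u j) * V j)\<^sup>2)"
    by (rule Cauchy_Schwarz_ineq_sum)
  also have "\<dots> = (\<Sum>j = 1..m. u j) * (\<Sum>j = 1..m. u j * (V j)\<^sup>2)"
    by (simp add: u power_mult_distrib)
  also have "\<dots> \<le> 1 / M k k * (\<Sum>j = 1..m. u j * (V j)\<^sup>2)"
    using sum_u u by (intro mult_right_mono sum_nonneg) auto
  finally have CS: "M k k * q\<^sup>2 \<le> (\<Sum>j = 1..m. u j * (V j)\<^sup>2)"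
    using d by (simp add: field_simps)
  have "2 * w k * V k - M k k * (w k)\<^sup>2 = (V k)\<^sup>2 / M k k - M k k * q\<^sup>2"
    unfolding w using d by (simp add: field_simps power2_eq_square)
  moreover have "(\<Sum>j = 1..k. \<Theta> k j * (V j)\<^sup>2) = (V k)\<^sup>2 / M k k - (\<Sum>j = 1..m. u j * (V j)\<^sup>2)"
    by (simp add: m u_def sum_negf doc_0)
  ultimately show ?thesis using CS by simp
qed

lemma dcc_energy_pos:
  assumes "n \<le> N" "k \<in> {1..n}" "w k \<noteq> 0"
  shows "0 < (\<Sum>k = 1..n. P n k * (\<Sum>j = 1..k. M k j * w j)\<^sup>2)"
proof -
  have "\<exists>i\<in>{1..n}. (\<Sum>j = 1..i. M i j * w j) \<noteq> 0"
  proof (rule ccontr)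
    assume "\<not> ?thesis"
    then have "(\<Sum>j = 1..k. \<Theta> k j * (\<Sum>l = 1..j. M j l * w l)) = 0"
      using assms by (intro sum.neutral) auto
    then show False using doc_inverts[of k w] assms by simp
  qed
  then obtain i where i: "i \<in> {1..n}" "(\<Sum>j = 1..i. M i j * w j) \<noteq> 0" by blast
  show ?thesis
  proof (rule sum_pos2[OF _ i(1)])
    show "0 < P n i * (\<Sum>j = 1..i. M i j * w j)\<^sup>2"
      using dcc_pos[of i n] i assms(1) by simp
  qed (use dcc_pos assms(1) in \<open>auto intro!: mult_nonneg_nonneg simp: less_imp_le\<close>)
qed

end

section \<open>Means of the weakly singular power kernel\<close>

definition omega_mean :: "real \<Rightarrow> real \<Rightarrow> real \<Rightarrow> real \<Rightarrow> real" where
  "omega_mean \<alpha> c a b = 1 / (b - a) * integral {a..b} (\<lambda>s. omega (1 - \<alpha>) (c - s))"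

lemma omega_pos: "0 < \<alpha> \<Longrightarrow> \<alpha> < 1 \<Longrightarrow> 0 < x \<Longrightarrow> 0 < omega (1 - \<alpha>) x"
  by (simp add: omega_def Gamma_real_pos)

lemma omega_strict_antimono:
  assumes "0 < \<alpha>" "\<alpha> < 1" "0 < x" "x < y"
  shows "omega (1 - \<alpha>) y < omega (1 - \<alpha>) x"
  using assms by (simp add: omega_def divide_strict_right_mono Gamma_real_pos powr_less_mono2_neg)

text \<open>
  For \<open>b < c\<close> the quotient \<open>\<omega>(c - s) / \<omega>(b - s)\<close> is a positive power of
  \<open>(b - s) / (c - s) = 1 - (c - b) / (c - s)\<close> and hence decreases in \<open>s\<close>.
\<close>

lemma omega_quotient_antimono:
  assumes "0 < \<alpha>" "\<alpha> < 1" "s \<le> s'" "s' < b" "b < c"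
  shows "omega (1 - \<alpha>) (c - s') * omega (1 - \<alpha>) (b - s)
    \<le> omega (1 - \<alpha>) (c - s) * omega (1 - \<alpha>) (b - s')"
proof -
  have "0 \<le> (c - b) * (s' - s)" using assms by simp
  then have "(c - s) * (b - s') \<le> (c - s') * (b - s)" by (simp add: algebra_simps)
  then have "((c - s') * (b - s)) powr (- \<alpha>) \<le> ((c - s) * (b - s')) powr (- \<alpha>)"
    using assms by (intro powr_mono2') auto
  then show ?thesis
    using assms by (simp add: omega_def powr_mult divide_right_mono Gamma_real_pos)
qed

definition omega_primitive :: "real \<Rightarrow> real \<Rightarrow> real \<Rightarrow> real" where
  "omega_primitive \<alpha> c s = - ((c - s) powr (1 - \<alpha>)) / ((1 - \<alpha>) * Gamma (1 - \<alpha>))"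

lemma omega_primitive_deriv:
  assumes "\<alpha> < 1" "s < c"
  shows "(omega_primitive \<alpha> c has_real_derivative omega (1 - \<alpha>) (c - s)) (at s)"
proof -
  have "((\<lambda>s. (c - s) powr (1 - \<alpha>)) has_real_derivative - ((1 - \<alpha>) * (c - s) powr (- \<alpha>))) (at s)"
    using assms by (auto intro!: derivative_eq_intros)
  from DERIV_cdivide[OF DERIV_minus[OF this], of "(1 - \<alpha>) * Gamma (1 - \<alpha>)"]
  show ?thesis
    using assms by (simp add: omega_primitive_def[abs_def] omega_def)
qed

lemma omega_primitive_continuous:
  assumes "\<alpha> < 1" "b \<le> c"
  shows "continuous_on {a..b} (omega_primitive \<alpha> c)"
proof -
  have "continuous_on {a..b} (\<lambda>s. (c - s) powr (1 - \<alpha>))"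
    using assms by (intro continuous_on_powr' continuous_intros) auto
  then show ?thesis
    unfolding omega_primitive_def divide_inverse
    by (rule continuous_on_mult_right[OF continuous_on_minus])
qed

text \<open>
  For \<open>b = c\<close> the integrand is unbounded near \<open>b\<close>, but its primitive is continuous up to \<open>b\<close>, so the
  fundamental theorem needs the derivative in the interior only.
\<close>

lemma omega_has_integral:
  assumes "\<alpha> < 1" "a \<le> b" "b \<le> c"
  shows "((\<lambda>s. omega (1 - \<alpha>) (c - s)) has_integral (omega_primitive \<alpha> c b - omega_primitive \<alpha> c a)) {a..b}"
proof (rule fundamental_theorem_of_calculus_interior)
  show "continuous_on {a..b} (omega_primitive \<alpha> c)"
    using assms by (intro omega_primitive_continuous)
  fix s assume "s \<in> {a<..<b}"
  then show "(omega_primitive \<alpha> c has_vector_derivative omega (1 - \<alpha>) (c - s)) (at s)"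
    using omega_primitive_deriv[of \<alpha> s c] assms
    by (simp add: has_real_derivative_iff_has_vector_derivative)
qed fact

lemma omega_mean_eq:
  assumes "\<alpha> < 1" "a < b" "b \<le> c"
  shows "omega_mean \<alpha> c a b = (omega_primitive \<alpha> c b - omega_primitive \<alpha> c a) / (b - a)"
  using omega_has_integral[of \<alpha> a b c] assms by (simp add: omega_mean_def integral_unique)

text \<open>
  Since \<open>\<xi>\<close> lies strictly inside the interval, means over adjacent intervals compare strictly; this
  strictness is the source of the positivity of the DCC kernels.
\<close>

lemma omega_mean_value:
  assumes "\<alpha> < 1" "a < b" "b \<le> c"
  shows "\<exists>\<xi>. a < \<xi> \<and> \<xi> < b \<and> omega_mean \<alpha> c a b = omega (1 - \<alpha>) (c - \<xi>)"
proof -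
  have "\<exists>l \<xi>. a < \<xi> \<and> \<xi> < b \<and> DERIV (omega_primitive \<alpha> c) \<xi> :> l \<and>
      omega_primitive \<alpha> c b - omega_primitive \<alpha> c a = (b - a) * l"
  proof (intro MVT omega_primitive_continuous)
    fix x assume "x < b"
    then show "omega_primitive \<alpha> c differentiable (at x)"
      using omega_primitive_deriv[of \<alpha> x c] assms by (auto simp: real_differentiable_def)
  qed (use assms in auto)
  then obtain l \<xi> where \<xi>: "a < \<xi>" "\<xi> < b" "DERIV (omega_primitive \<alpha> c) \<xi> :> l"
      "omega_primitive \<alpha> c b - omega_primitive \<alpha> c a = (b - a) * l"
    by blast
  moreover have "l = omega (1 - \<alpha>) (c - \<xi>)"
    using DERIV_unique[OF \<xi>(3) omega_primitive_deriv] assms \<xi> by simp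
  ultimately show ?thesis using assms by (auto simp: omega_mean_eq)
qed

lemma omega_mean_pos:
  assumes "0 < \<alpha>" "\<alpha> < 1" "a < b" "b \<le> c"
  shows "0 < omega_mean \<alpha> c a b"
proof -
  obtain \<xi> where "\<xi> < b" "omega_mean \<alpha> c a b = omega (1 - \<alpha>) (c - \<xi>)"
    using omega_mean_value[of \<alpha> a b c] assms by auto
  then show ?thesis using assms omega_pos[of \<alpha> "c - \<xi>"] by simp
qed

lemma omega_mean_mono:
  assumes "0 < \<alpha>" "\<alpha> < 1" "a < b" "b < b'" "b' \<le> c"
  shows "omega_mean \<alpha> c a b < omega_mean \<alpha> c b b'"
proof -
  obtain \<xi> where \<xi>: "\<xi> < b" "omega_mean \<alpha> c a b = omega (1 - \<alpha>) (c - \<xi>)"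
    using omega_mean_value[of \<alpha> a b c] assms by auto
  obtain \<eta> where \<eta>: "b < \<eta>" "\<eta> < b'" "omega_mean \<alpha> c b b' = omega (1 - \<alpha>) (c - \<eta>)"
    using omega_mean_value[of \<alpha> b b' c] assms by auto
  show ?thesis using \<xi> \<eta> assms omega_strict_antimono[of \<alpha> "c - \<eta>" "c - \<xi>"] by simp
qed

lemma omega_mean_compare:
  assumes "\<alpha> < 1" "a < b" "b \<le> c" "b \<le> c'"
    and "\<And>s. a \<le> s \<Longrightarrow> s \<le> b \<Longrightarrow> u * omega (1 - \<alpha>) (c - s) \<le> v * omega (1 - \<alpha>) (c' - s)"
  shows "u * omega_mean \<alpha> c a b \<le> v * omega_mean \<alpha> c' a b"
proof -
  have "u * integral {a..b} (\<lambda>s. omega (1 - \<alpha>) (c - s)) \<le> v * integral {a..b} (\<lambda>s. omega (1 - \<alpha>) (c' - s))"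
  proof (rule has_integral_le)
    show "((\<lambda>s. u * omega (1 - \<alpha>) (c - s)) has_integral
        u * integral {a..b} (\<lambda>s. omega (1 - \<alpha>) (c - s))) {a..b}"
      by (rule has_integral_mult_right[OF integrable_integral[OF has_integral_integrable]],
          rule omega_has_integral) (use assms in auto)
    show "((\<lambda>s. v * omega (1 - \<alpha>) (c' - s)) has_integral
        v * integral {a..b} (\<lambda>s. omega (1 - \<alpha>) (c' - s))) {a..b}"
      by (rule has_integral_mult_right[OF integrable_integral[OF has_integral_integrable]],
          rule omega_has_integral) (use assms in auto)
  qed (use assms(5) in auto)
  then show ?thesis
    using assms(2) by (simp add: omega_mean_def divide_right_mono)
qed

lemma powr_one_minus:
  fixes x :: real
  shows "0 < x \<Longrightarrow> x powr (1 - \<alpha>) = x * x powr (- \<alpha>)"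
  by (simp add: powr_diff powr_minus field_simps)

text \<open>
  The mean up to the singularity is exactly \<open>1 / (1 - \<alpha>)\<close> times the value at the left end.  For an
  interval \<open>{a..b}\<close> with \<open>b \<le> c\<close> the same multiple is an upper bound, independently of the length;
  this makes intervals of different length comparable.
\<close>

lemma omega_mean_to_singularity:
  assumes "\<alpha> < 1" "a < c"
  shows "omega_mean \<alpha> c a c = omega (1 - \<alpha>) (c - a) / (1 - \<alpha>)"
  using assms by (simp add: omega_mean_eq omega_primitive_def omega_def powr_one_minus mult.commute)

lemma omega_mean_le_left:
  assumes "0 < \<alpha>" "\<alpha> < 1" "a < b" "b < c"
  shows "omega_mean \<alpha> c a b \<le> omega (1 - \<alpha>) (c - a) / (1 - \<alpha>)"
proof -
  have G: "0 < (1 - \<alpha>) * Gamma (1 - \<alpha>)" using assms Gamma_real_pos[of "1 - \<alpha>"] by simp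
  have "(c - b) * (c - a) powr (- \<alpha>) \<le> (c - b) * (c - b) powr (- \<alpha>)"
    using assms by (intro mult_left_mono powr_mono2') auto
  then have "(c - a) powr (1 - \<alpha>) - (c - b) powr (1 - \<alpha>) \<le> (b - a) * (c - a) powr (- \<alpha>)"
    using assms by (simp add: powr_one_minus algebra_simps)
  then have "((c - a) powr (1 - \<alpha>) - (c - b) powr (1 - \<alpha>)) / ((1 - \<alpha>) * Gamma (1 - \<alpha>)) / (b - a)
      \<le> ((b - a) * (c - a) powr (- \<alpha>)) / ((1 - \<alpha>) * Gamma (1 - \<alpha>)) / (b - a)"
    using assms G by (intro divide_right_mono) auto
  moreover have "omega_mean \<alpha> c a b
      = ((c - a) powr (1 - \<alpha>) - (c - b) powr (1 - \<alpha>)) / ((1 - \<alpha>) * Gamma (1 - \<alpha>)) / (b - a)"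
    using assms by (simp add: omega_mean_eq omega_primitive_def diff_divide_distrib)
  moreover have "((b - a) * (c - a) powr (- \<alpha>)) / ((1 - \<alpha>) * Gamma (1 - \<alpha>)) / (b - a)
      = omega (1 - \<alpha>) (c - a) / (1 - \<alpha>)"
    using assms by (simp add: omega_def mult.commute)
  ultimately show ?thesis by simp
qed

section \<open>The auxiliary L1h kernels\<close>

locale mesh =
  fixes \<alpha> :: real and t :: "nat \<Rightarrow> real" and N :: nat
  assumes alpha: "0 < \<alpha>" "\<alpha> < 1"
    and incr: "1 \<le> k \<Longrightarrow> k \<le> N \<Longrightarrow> t (k - 1) < t k"
begin

abbreviation K :: "nat \<Rightarrow> nat \<Rightarrow> real" where "K n k \<equiv> aux_l1h \<alpha> t n (n - k)"
abbreviation c :: "nat \<Rightarrow> real" where "c \<equiv> midpt t"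
abbreviation \<omega> :: "real \<Rightarrow> real" where "\<omega> \<equiv> omega (1 - \<alpha>)"

lemma mesh_mono: "i \<le> j \<Longrightarrow> j \<le> N \<Longrightarrow> t i \<le> t j"
proof (induction j rule: dec_induct)
  case (step m)
  then show ?case using incr[of "Suc m"] by simp
qed simp

lemma node_less_midpt:
  assumes "k < n" "n \<le> N"
  shows "t k < c n"
proof -
  have "t k \<le> t (n - 1)" using assms by (intro mesh_mono) auto
  then show ?thesis using incr[of n] assms by (simp add: midpt_def)
qed

lemma midpt_less_node: "1 \<le> n \<Longrightarrow> n \<le> N \<Longrightarrow> c n < t n"
  using incr[of n] by (simp add: midpt_def)

lemma midpt_less: "1 \<le> n \<Longrightarrow> Suc n \<le> N \<Longrightarrow> c n < c (Suc n)"
  using midpt_less_node[of n] node_less_midpt[of n "Suc n"] by simp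

lemma aux_offdiag_eq_mean:
  assumes "1 \<le> k" "k < n" "n \<le> N"
  shows "K n k = omega_mean \<alpha> (c n) (t (k - 1)) (t k)"
  using assms node_less_midpt[of k n]
  by (simp add: aux_l1h_def l1h_def omega_mean_def step_def)

text \<open>
  On the diagonal only half of the cell is integrated while the division is by its full length;
  the factor 2 makes the kernel a mean.
\<close>

lemma aux_diag_eq_mean:
  assumes "1 \<le> n" "n \<le> N"
  shows "K n n = omega_mean \<alpha> (c n) (t (n - 1)) (c n)"
proof -
  have "step t n = 2 * (c n - t (n - 1))" by (simp add: step_def midpt_def field_simps)
  then show ?thesis
    using assms midpt_less_node[of n]
    by (simp add: aux_l1h_def l1h_def omega_mean_def del: right_diff_distrib_numeral)
qed

lemma aux_pos:
  assumes "1 \<le> k" "k \<le> n" "n \<le> N"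
  shows "0 < K n k"
proof (cases "k = n")
  case True
  have "0 < omega_mean \<alpha> (c n) (t (n - 1)) (c n)"
    using assms True alpha node_less_midpt[of "n - 1" n] by (intro omega_mean_pos) auto
  then show ?thesis using aux_diag_eq_mean[of n] assms True by simp
next
  case False
  then show ?thesis
    using assms alpha incr[of k] node_less_midpt[of k n]
    by (subst aux_offdiag_eq_mean) (auto intro!: omega_mean_pos)
qed

lemma aux_row_mono:
  assumes "1 \<le> k" "k < n" "n \<le> N"
  shows "K n k < K n (Suc k)"
proof (cases "Suc k = n")
  case True
  then have "K n (Suc k) = omega_mean \<alpha> (c n) (t k) (c n)"
    using aux_diag_eq_mean[of n] assms by auto
  then show ?thesis
    using assms alpha incr[of k] node_less_midpt[of k n]
    by (auto simp: aux_offdiag_eq_mean intro!: omega_mean_mono)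
next
  case False
  then have "K n (Suc k) = omega_mean \<alpha> (c n) (t k) (t (Suc k))"
    using aux_offdiag_eq_mean[of "Suc k" n] assms by auto
  then show ?thesis
    using False assms alpha incr[of k] incr[of "Suc k"] node_less_midpt[of "Suc k" n]
    by (auto simp: aux_offdiag_eq_mean intro!: omega_mean_mono)
qed

text \<open>
  The quotient \<open>K (Suc n) k / K n k\<close> is at most the value of the decreasing function
  \<open>\<omega>(c (Suc n) - s) / \<omega>(c n - s)\<close> at the left end of the \<open>k\<close>-th cell, and in the next lemma at least its
  value at the right end.  Consecutive quotients are thus separated by the values at the nodes.
\<close>

lemma aux_quotient_upper:
  assumes "1 \<le> k" "k \<le> n" "Suc n \<le> N"
  shows "\<omega> (c n - t (k - 1)) * K (Suc n) k \<le> \<omega> (c (Suc n) - t (k - 1)) * K n k"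
proof (cases "k = n")
  case True
  let ?f = "\<omega> (c n - t (n - 1))" and ?g = "\<omega> (c (Suc n) - t (n - 1))"
  have nodes: "t (n - 1) < t n" "t n < c (Suc n)" "t (n - 1) < c n"
    using True assms incr[of n] node_less_midpt[of n "Suc n"] node_less_midpt[of "n - 1" n] by auto
  have "K (Suc n) n \<le> ?g / (1 - \<alpha>)"
    using True assms alpha nodes by (subst aux_offdiag_eq_mean) (auto intro!: omega_mean_le_left)
  moreover have "0 < ?f" using alpha nodes by (intro omega_pos) auto
  ultimately have "?f * K (Suc n) n \<le> ?f * (?g / (1 - \<alpha>))"
    by (intro mult_left_mono) auto
  also have "\<dots> = ?g * (?f / (1 - \<alpha>))" by simp
  also have "?f / (1 - \<alpha>) = K n n"
    using True assms alpha nodes aux_diag_eq_mean[of n] omega_mean_to_singularity[of \<alpha> "t (n - 1)" "c n"]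
    by simp
  finally show ?thesis unfolding True .
next
  case False
  then have "k < n" using assms by simp
  then have nodes: "t k < c n" "c n < c (Suc n)" "t (k - 1) < t k"
    using assms node_less_midpt[of k n] midpt_less[of n] incr[of k] by auto
  have means: "K (Suc n) k = omega_mean \<alpha> (c (Suc n)) (t (k - 1)) (t k)"
      "K n k = omega_mean \<alpha> (c n) (t (k - 1)) (t k)"
    using assms \<open>k < n\<close> aux_offdiag_eq_mean[of k "Suc n"] aux_offdiag_eq_mean[of k n] by auto
  show ?thesis
    unfolding means
  proof (rule omega_mean_compare)
    fix s assume "t (k - 1) \<le> s" "s \<le> t k"
    then show "\<omega> (c n - t (k - 1)) * \<omega> (c (Suc n) - s) \<le> \<omega> (c (Suc n) - t (k - 1)) * \<omega> (c n - s)"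
      using alpha nodes omega_quotient_antimono[of \<alpha> "t (k - 1)" s "c n" "c (Suc n)"]
      by (simp add: mult.commute)
  qed (use alpha nodes in auto)
qed

lemma aux_quotient_lower:
  assumes "1 \<le> k" "k < n" "Suc n \<le> N"
  shows "\<omega> (c (Suc n) - t k) * K n k \<le> \<omega> (c n - t k) * K (Suc n) k"
proof -
  have nodes: "t k < c n" "c n < c (Suc n)" "t (k - 1) < t k"
    using assms node_less_midpt[of k n] midpt_less[of n] incr[of k] by auto
  have means: "K (Suc n) k = omega_mean \<alpha> (c (Suc n)) (t (k - 1)) (t k)"
      "K n k = omega_mean \<alpha> (c n) (t (k - 1)) (t k)"
    using assms aux_offdiag_eq_mean[of k "Suc n"] aux_offdiag_eq_mean[of k n] by auto
  show ?thesis
    unfolding means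
  proof (rule omega_mean_compare)
    fix s assume "t (k - 1) \<le> s" "s \<le> t k"
    then show "\<omega> (c (Suc n) - t k) * \<omega> (c n - s) \<le> \<omega> (c n - t k) * \<omega> (c (Suc n) - s)"
      using alpha nodes omega_quotient_antimono[of \<alpha> s "t k" "c n" "c (Suc n)"]
      by (simp add: mult.commute)
  qed (use alpha nodes in auto)
qed

lemma aux_col_antimono:
  assumes "1 \<le> k" "k \<le> n" "Suc n \<le> N"
  shows "K (Suc n) k \<le> K n k"
proof -
  let ?f = "\<omega> (c n - t (k - 1))" and ?g = "\<omega> (c (Suc n) - t (k - 1))"
  have lt: "t (k - 1) < c n" "c n < c (Suc n)"
    using assms node_less_midpt[of "k - 1" n] midpt_less[of n] by auto
  have "?f * K (Suc n) k \<le> ?g * K n k" using assms by (rule aux_quotient_upper)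
  also have "\<dots> \<le> ?f * K n k"
    using alpha lt omega_strict_antimono[of \<alpha> "c n - t (k - 1)" "c (Suc n) - t (k - 1)"]
      aux_pos[of k n] assms
    by (intro mult_right_mono) auto
  finally show ?thesis using alpha lt omega_pos[of \<alpha> "c n - t (k - 1)"] by simp
qed

lemma aux_minor:
  assumes "1 \<le> k" "k < j" "j \<le> n" "Suc n \<le> N"
  shows "K n k * K (Suc n) j \<le> K n j * K (Suc n) k"
proof -
  let ?fk = "\<omega> (c n - t k)" and ?gk = "\<omega> (c (Suc n) - t k)"
  let ?fj = "\<omega> (c n - t (j - 1))" and ?gj = "\<omega> (c (Suc n) - t (j - 1))"
  have lt: "t k < c n" "t (j - 1) < c n" "c n < c (Suc n)" "t k \<le> t (j - 1)"
    using assms by (auto intro!: node_less_midpt midpt_less mesh_mono)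
  have pos: "0 < ?gk" "0 < ?fj" "0 < ?fk" "0 < K n k" "0 < K (Suc n) j" "0 < K n j" "0 < K (Suc n) k"
    using lt alpha assms by (simp_all add: omega_pos aux_pos del: diff_Suc_Suc)
  have "(?gk * ?fj) * (K n k * K (Suc n) j) = (?gk * K n k) * (?fj * K (Suc n) j)"
    by (simp only: ac_simps)
  also have "\<dots> \<le> (?fk * K (Suc n) k) * (?gj * K n j)"
    by (rule mult_mono[OF aux_quotient_lower aux_quotient_upper])
       (use assms pos in \<open>simp_all add: less_imp_le\<close>)
  also have "\<dots> = (?gj * ?fk) * (K n j * K (Suc n) k)" by (simp only: ac_simps)
  also have "\<dots> \<le> (?gk * ?fj) * (K n j * K (Suc n) k)"
    by (rule mult_right_mono[OF omega_quotient_antimono])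
       (use alpha lt pos in \<open>simp_all add: less_imp_le\<close>)
  finally show ?thesis using pos by (simp only: mult_le_cancel_left_pos mult_pos_pos)
qed

lemma monotone_kernel_aux: "monotone_kernel (aux_l1h \<alpha> t) N"
  by unfold_locales (fact aux_pos aux_row_mono aux_col_antimono aux_minor)+

end

lemma aux_convolution_eq:
  assumes "1 \<le> k"
  shows "(\<Sum>j = 1..k. aux_l1h \<alpha> t k (k - j) * w j)
    = (\<Sum>j = 1..k. l1h \<alpha> t k (k - j) * w j) + aux_l1h \<alpha> t k 0 / 2 * w k"
proof -
  obtain m where m: "k = Suc m" using assms by (cases k) auto
  have "(\<Sum>j = 1..m. aux_l1h \<alpha> t k (k - j) * w j) = (\<Sum>j = 1..m. l1h \<alpha> t k (k - j) * w j)"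
    by (intro sum.cong refl) (auto simp: aux_l1h_def m)
  then show ?thesis by (simp add: m aux_l1h_def)
qed

section \<open>Positive definiteness\<close>

theorem theorem2p2:
  fixes \<alpha> T :: real and t w :: "nat \<Rightarrow> real" and N n :: nat
  assumes alpha: "0 < \<alpha>" "\<alpha> < 1"
    and mesh: "t 0 = 0" "\<forall>k\<in>{1..N}. t (k - 1) < t k" "t N = T"
    and n: "1 \<le> n" "n \<le> N"
  defines "a \<equiv> l1h \<alpha> t"
    and "A \<equiv> aux_l1h \<alpha> t"
    and "p \<equiv> dcc (aux_l1h \<alpha> t)"
  shows "(\<forall>k\<in>{1..n}.
            2 * w k * (\<Sum>j = 1..k. a k (k - j) * w j) \<ge>
              (\<Sum>j = 1..k. p k (k - j) * (\<Sum>l = 1..j. A j (j - l) * w l)\<^sup>2)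
              - (\<Sum>j = 1..k - 1. p (k - 1) (k - 1 - j) * (\<Sum>l = 1..j. A j (j - l) * w l)\<^sup>2))
       \<and> 2 * (\<Sum>k = 1..n. w k * (\<Sum>j = 1..k. a k (k - j) * w j)) \<ge>
              (\<Sum>k = 1..n. p n (n - k) * (\<Sum>j = 1..k. A k (k - j) * w j)\<^sup>2)
       \<and> ((\<exists>k\<in>{1..n}. w k \<noteq> 0) \<longrightarrow>
              (\<Sum>k = 1..n. p n (n - k) * (\<Sum>j = 1..k. A k (k - j) * w j)\<^sup>2) > 0)"
proof -
  interpret mesh \<alpha> t n
    using alpha mesh n by unfold_locales auto
  interpret monotone_kernel A n
    unfolding A_def by (rule monotone_kernel_aux)
  have p: "p = dcc A" by (simp add: p_def A_def)
  define V where "V j = (\<Sum>l = 1..j. A j (j - l) * w l)" for j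
  define E where "E k = (\<Sum>j = 1..k. p k (k - j) * (V j)\<^sup>2)" for k
  define B where "B k = (\<Sum>j = 1..k. a k (k - j) * w j)" for k
  have local: "E k - E (k - 1) \<le> 2 * w k * B k" if k: "k \<in> {1..n}" for k
  proof -
    have V: "V k = B k + A k 0 / 2 * w k"
      using k aux_convolution_eq[of k] by (simp add: V_def B_def a_def A_def)
    have "E k - E (k - 1) = (\<Sum>j = 1..k. doc A k (k - j) * (V j)\<^sup>2)"
      using k dcc_weighted_sum_diff[of k "\<lambda>j. (V j)\<^sup>2"] by (simp add: E_def p)
    also have "\<dots> \<le> 2 * w k * V k - A k 0 * (w k)\<^sup>2"
      using k doc_quadratic_bound[of k w] by (simp add: V_def)
    also have "\<dots> = 2 * w k * B k"
      unfolding V by (simp add: algebra_simps power2_eq_square)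
    finally show ?thesis .
  qed
  have "E m \<le> 2 * (\<Sum>k = 1..m. w k * B k)" if "m \<le> n" for m
    using that
  proof (induction m)
    case 0
    show ?case by (simp add: E_def)
  next
    case (Suc m)
    then show ?case using local[of "Suc m"] by (simp add: algebra_simps)
  qed
  then have "E n \<le> 2 * (\<Sum>k = 1..n. w k * B k)" by simp
  moreover have "0 < E n" if "\<exists>k\<in>{1..n}. w k \<noteq> 0"
    using that dcc_energy_pos[of n _ w] by (auto simp: E_def V_def p)
  ultimately show ?thesis
    using local unfolding E_def V_def B_def by blast
qed

end
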